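(* Let $\mathcal{M}$ be a von Neumann algebra and let $\preceq$ be the star order on $\mathcal{M}$. (i) If $(x_\alpha)_{\alpha\in\Gamma}$ is an increasing net in $(\mathcal{M},\preceq)$ that is bounded above in $(\mathcal{M},\preceq)$, then the strong (operator) limit of $(x_\alpha)_{\alpha\in\Gamma}$ exists and it is equal to the supremum of $(x_\alpha)_{\alpha\in\Gamma}$ in $(\mathcal{M},\preceq)$. (ii) If $(x_\alpha)_{\alpha\in\Gamma}$ is a decreasing net in $(\mathcal{M},\preceq)$, then the strong (operator) limit of $(x_\alpha)_{\alpha\in\Gamma}$ exists and is equal to the infimum of $(x_\alpha)_{\alpha\in\Gamma}$ in $(\mathcal{M},\preceq)$.
   Context: A von Neumann algebra is a strongly closed C*-subalgebra of the C*-algebra $\mathscr{B}(\mathscr{H})$ of all bounded operators on a complex Hilbert space $\mathscr{H}$. The strong (operator) topology is the locally convex topology on $\mathscr{B}(\mathscr{H})$ generated by the semi-norms $x\mapsto\|x\xi\|$, $\xi\in\mathscr{H}$. The star order on a von Neumann algebra $\mathcal{M}$ is the partial order defined by $x\preceq y$ if and only if $x^*x=x^*y$ and $xx^*=yx^*$. A net $(x_\alpha)_{\alpha\in\Gamma}$ is increasing (resp. decreasing) in $(\mathcal{M},\preceq)$ if $\alpha\leq\beta$ implies $x_\alpha\preceq x_\beta$ (resp. $x_\beta\preceq x_\alpha$). *)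

theory Defs
  imports "HOL-Analysis.Analysis" "HOL-Algebra.Order"
begin

section \<open>Complex Hilbert spaces\<close>

text \<open>
  The real Hilbert space underlying a complex one carries the real part of the complex inner
  product, so that the norm and the topology are those of the classes \<open>real_inner\<close> and
  \<open>complete_space\<close>. Positive definiteness of \<open>cinner\<close> follows from that of \<open>inner\<close>, since
  \<open>cinner x x\<close> is real. The inner product is linear in its first argument.
\<close>

class complex_hilbert = real_inner + complete_space +
  fixes scaleC :: "complex \<Rightarrow> 'a \<Rightarrow> 'a" (infixr \<open>*\<^sub>C\<close> 75)
    and cinner :: "'a \<Rightarrow> 'a \<Rightarrow> complex"
  assumes scaleC_add_right: "c *\<^sub>C (x + y) = c *\<^sub>C x + c *\<^sub>C y"
    and scaleC_add_left: "(c + d) *\<^sub>C x = c *\<^sub>C x + d *\<^sub>C x"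
    and scaleC_scaleC: "c *\<^sub>C (d *\<^sub>C x) = (c * d) *\<^sub>C x"
    and scaleR_eq_scaleC: "scaleR r x = complex_of_real r *\<^sub>C x"
    and cinner_commute: "cinner x y = cnj (cinner y x)"
    and cinner_add_left: "cinner (x + y) z = cinner x z + cinner y z"
    and cinner_scaleC_left: "cinner (c *\<^sub>C x) y = c * cinner x y"
    and inner_eq_Re_cinner: "inner x y = Re (cinner x y)"

lemma norm_scaleC: "norm (c *\<^sub>C x) = cmod c * norm (x :: 'a :: complex_hilbert)"
proof -
  have "cinner (c *\<^sub>C x) (c *\<^sub>C x) = c * cnj c * cinner x x"
    by (subst cinner_scaleC_left, subst cinner_commute, subst cinner_scaleC_left)
       (simp add: cinner_commute[of x x, symmetric])
  also have "c * cnj c = complex_of_real ((cmod c)\<^sup>2)"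
    by (rule complex_norm_square[symmetric])
  finally have "inner (c *\<^sub>C x) (c *\<^sub>C x) = (cmod c)\<^sup>2 * inner x x"
    by (simp add: inner_eq_Re_cinner flip: of_real_power)
  then show ?thesis
    by (simp add: norm_eq_sqrt_inner real_sqrt_mult)
qed

lemma bounded_linear_scaleC: "bounded_linear (\<lambda>x :: 'a :: complex_hilbert. c *\<^sub>C x)"
proof (rule bounded_linear_intro[where K = "cmod c"])
  show "c *\<^sub>C (r *\<^sub>R x) = r *\<^sub>R (c *\<^sub>C x)" for r and x :: 'a
    by (simp add: scaleR_eq_scaleC scaleC_scaleC mult.commute)
qed (simp_all add: scaleC_add_right norm_scaleC mult.commute)

instantiation complex :: complex_hilbert
begin

definition scaleC_complex :: "complex \<Rightarrow> complex \<Rightarrow> complex"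
  where "scaleC_complex c x = c * x"

definition cinner_complex :: "complex \<Rightarrow> complex \<Rightarrow> complex"
  where "cinner_complex x y = x * cnj y"

instance
  by standard (auto simp: scaleC_complex_def cinner_complex_def inner_complex_def
      algebra_simps scaleR_conv_of_real)

end


section \<open>Bounded operators\<close>

text \<open>
  Real bounded linear operators are \<open>'h \<Rightarrow>\<^sub>L 'h\<close>; the bounded operators on the complex
  Hilbert space \<open>'h\<close> are those that commute with complex scalars. The operator norm is the same.
\<close>

definition bounded_ops :: "('h :: complex_hilbert \<Rightarrow>\<^sub>L 'h) set"
  where "bounded_ops = {x. \<forall>c \<xi>. blinfun_apply x (c *\<^sub>C \<xi>) = c *\<^sub>C blinfun_apply x \<xi>}"

lift_definition op_scaleC :: "complex \<Rightarrow> ('h :: complex_hilbert \<Rightarrow>\<^sub>L 'h) \<Rightarrow> ('h \<Rightarrow>\<^sub>L 'h)"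
  is "\<lambda>c x \<xi>. c *\<^sub>C x \<xi>"
  by (rule bounded_linear_compose[OF bounded_linear_scaleC])

definition op_adj :: "('h :: complex_hilbert \<Rightarrow>\<^sub>L 'h) \<Rightarrow> ('h \<Rightarrow>\<^sub>L 'h)"
  where "op_adj x = (THE y. y \<in> bounded_ops \<and>
    (\<forall>\<xi> \<eta>. cinner (blinfun_apply x \<xi>) \<eta> = cinner \<xi> (blinfun_apply y \<eta>)))"

text \<open>
  The library's \<open>strong_operator_topology\<close> is the topology of pointwise norm convergence on
  \<open>'h \<Rightarrow>\<^sub>L 'h\<close>, i.e. the one generated by the seminorms \<open>\<lambda>x. norm (blinfun_apply x \<xi>)\<close>.
\<close>

definition strong_topology :: "('h :: complex_hilbert \<Rightarrow>\<^sub>L 'h) topology"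
  where "strong_topology = subtopology strong_operator_topology bounded_ops"


section \<open>Von Neumann algebras and the star order\<close>

text \<open>The identity operator is not required to belong to the algebra.\<close>

definition cstar_subalgebra :: "('h :: complex_hilbert \<Rightarrow>\<^sub>L 'h) set \<Rightarrow> bool"
  where "cstar_subalgebra M \<longleftrightarrow>
    M \<subseteq> bounded_ops \<and> 0 \<in> M \<and>
    (\<forall>x\<in>M. \<forall>y\<in>M. x + y \<in> M) \<and>
    (\<forall>c. \<forall>x\<in>M. op_scaleC c x \<in> M) \<and>
    (\<forall>x\<in>M. \<forall>y\<in>M. x o\<^sub>L y \<in> M) \<and>
    (\<forall>x\<in>M. op_adj x \<in> M) \<and>
    closed M"

definition von_neumann_algebra :: "('h :: complex_hilbert \<Rightarrow>\<^sub>L 'h) set \<Rightarrow> bool"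
  where "von_neumann_algebra M \<longleftrightarrow> cstar_subalgebra M \<and> closedin strong_topology M"

definition star_le :: "('h :: complex_hilbert \<Rightarrow>\<^sub>L 'h) \<Rightarrow> ('h \<Rightarrow>\<^sub>L 'h) \<Rightarrow> bool"
    (infix \<open>\<preceq>\<^sub>*\<close> 50)
  where "x \<preceq>\<^sub>* y \<longleftrightarrow>
    op_adj x o\<^sub>L x = op_adj x o\<^sub>L y \<and> x o\<^sub>L op_adj x = y o\<^sub>L op_adj x"

definition star_order :: "('h :: complex_hilbert \<Rightarrow>\<^sub>L 'h) set \<Rightarrow> ('h \<Rightarrow>\<^sub>L 'h) gorder"
  where "star_order M = \<lparr>carrier = M, eq = (=), le = star_le\<rparr>"

lemma is_lub_star_order:
  assumes "A \<subseteq> M"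
  shows "is_lub (star_order M) s A \<longleftrightarrow>
    s \<in> M \<and> (\<forall>x\<in>A. x \<preceq>\<^sub>* s) \<and> (\<forall>u\<in>M. (\<forall>x\<in>A. x \<preceq>\<^sub>* u) \<longrightarrow> s \<preceq>\<^sub>* u)"
proof -
  have "A \<inter> M = A"
    using assms by blast
  with assms show ?thesis
    by (auto simp: least_def Upper_def star_order_def simp flip: Int_iff)
qed

lemma is_glb_star_order:
  assumes "A \<subseteq> M"
  shows "is_glb (star_order M) s A \<longleftrightarrow>
    s \<in> M \<and> (\<forall>x\<in>A. s \<preceq>\<^sub>* x) \<and> (\<forall>u\<in>M. (\<forall>x\<in>A. u \<preceq>\<^sub>* x) \<longrightarrow> u \<preceq>\<^sub>* s)"
proof -
  have "A \<inter> M = A"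
    using assms by blast
  with assms show ?thesis
    by (auto simp: greatest_def Lower_def star_order_def simp flip: Int_iff)
qed


section \<open>Nets\<close>

definition directed_set :: "'i set \<Rightarrow> ('i \<Rightarrow> 'i \<Rightarrow> bool) \<Rightarrow> bool"
  where "directed_set \<Gamma> leq \<longleftrightarrow> \<Gamma> \<noteq> {} \<and> reflp_on \<Gamma> leq \<and> transp_on \<Gamma> leq \<and>
    (\<forall>\<alpha>\<in>\<Gamma>. \<forall>\<beta>\<in>\<Gamma>. \<exists>\<gamma>\<in>\<Gamma>. leq \<alpha> \<gamma> \<and> leq \<beta> \<gamma>)"

text \<open>The filter of tails; convergence of a net indexed by \<open>\<Gamma>\<close> is convergence along it.\<close>

definition net_filter :: "'i set \<Rightarrow> ('i \<Rightarrow> 'i \<Rightarrow> bool) \<Rightarrow> 'i filter"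
  where "net_filter \<Gamma> leq = (INF \<alpha>\<in>\<Gamma>. principal {\<beta>\<in>\<Gamma>. leq \<alpha> \<beta>})"

lemma eventually_net_filter:
  assumes "directed_set \<Gamma> leq"
  shows "eventually P (net_filter \<Gamma> leq) \<longleftrightarrow> (\<exists>\<alpha>\<in>\<Gamma>. \<forall>\<beta>\<in>\<Gamma>. leq \<alpha> \<beta> \<longrightarrow> P \<beta>)"
  unfolding net_filter_def
proof (subst eventually_INF_base)
  fix \<alpha> \<beta> assume "\<alpha> \<in> \<Gamma>" "\<beta> \<in> \<Gamma>"
  then obtain \<gamma> where "\<gamma> \<in> \<Gamma>" "leq \<alpha> \<gamma>" "leq \<beta> \<gamma>"
    using assms unfolding directed_set_def by blast
  moreover have "transp_on \<Gamma> leq"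
    using assms by (simp add: directed_set_def)
  ultimately show "\<exists>\<gamma>\<in>\<Gamma>. principal {\<beta>\<in>\<Gamma>. leq \<gamma> \<beta>} \<le>
      inf (principal {\<gamma>\<in>\<Gamma>. leq \<alpha> \<gamma>}) (principal {\<gamma>\<in>\<Gamma>. leq \<beta> \<gamma>})"
    using \<open>\<alpha> \<in> \<Gamma>\<close> \<open>\<beta> \<in> \<Gamma>\<close>
    by (intro bexI[of _ \<gamma>]) (auto dest: transp_onD)
qed (use assms in \<open>auto simp: directed_set_def eventually_principal\<close>)

definition star_increasing_net ::
    "'i set \<Rightarrow> ('i \<Rightarrow> 'i \<Rightarrow> bool) \<Rightarrow> ('i \<Rightarrow> ('h :: complex_hilbert \<Rightarrow>\<^sub>L 'h)) \<Rightarrow> bool"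
  where "star_increasing_net \<Gamma> leq x \<longleftrightarrow> (\<forall>\<alpha>\<in>\<Gamma>. \<forall>\<beta>\<in>\<Gamma>. leq \<alpha> \<beta> \<longrightarrow> x \<alpha> \<preceq>\<^sub>* x \<beta>)"

definition star_decreasing_net ::
    "'i set \<Rightarrow> ('i \<Rightarrow> 'i \<Rightarrow> bool) \<Rightarrow> ('i \<Rightarrow> ('h :: complex_hilbert \<Rightarrow>\<^sub>L 'h)) \<Rightarrow> bool"
  where "star_decreasing_net \<Gamma> leq x \<longleftrightarrow> (\<forall>\<alpha>\<in>\<Gamma>. \<forall>\<beta>\<in>\<Gamma>. leq \<alpha> \<beta> \<longrightarrow> x \<beta> \<preceq>\<^sub>* x \<alpha>)"

end

theory Submission
  imports Defs
begin

text \<open>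
  Two consequences of \<open>x \<preceq>\<^sub>* y\<close> carry the proof. Since \<open>x\<^sup>*x = x\<^sup>*y\<close> makes the range of \<open>x\<close>
  orthogonal to the range of \<open>y - x\<close>, Pythagoras gives
  \<open>\<parallel>y \<xi> - x \<xi>\<parallel>\<^sup>2 = \<parallel>y \<xi>\<parallel>\<^sup>2 - \<parallel>x \<xi>\<parallel>\<^sup>2\<close>. Hence along a monotone net the numbers
  \<open>\<parallel>x\<^sub>\<alpha> \<xi>\<parallel>\<^sup>2\<close> are monotone, and bounded (by the given upper bound, respectively by \<open>0\<close>), so they
  converge; by the same identity the vectors \<open>x\<^sub>\<alpha> \<xi>\<close> form a Cauchy net for every \<open>\<xi>\<close>. The
  pointwise limit \<open>s\<close> is a bounded operator, and it lies in the algebra because the algebra is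
  strongly closed.

  That \<open>s\<close> is the supremum or infimum is a passage to the limit in the two equations that define
  the order. The first one, in the form
  \<open>\<langle>x \<xi>, x \<eta>\<rangle> = \<langle>x \<xi>, y \<eta>\<rangle>\<close>, is stable under strong limits in both arguments. The second,
  \<open>xx\<^sup>* = yx\<^sup>*\<close>, is delicate because taking adjoints is not strongly continuous. The remedy is that
  \<open>ax\<^sup>* = bx\<^sup>*\<close> is equivalent to \<open>xa\<^sup>* = xb\<^sup>*\<close> (take adjoints of both sides): one writes
  the equation so that the operator that tends to its limit is not under the adjoint sign, passes to
  the limit, and goes back.

  All this needs adjoints to exist, that is, the Riesz representation theorem, which is obtained
  by minimising \<open>\<parallel>v\<parallel>\<^sup>2 - 2 f v\<close>.
\<close>

section \<open>Riesz representation\<close>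

text \<open>
  The functional \<open>J v = \<parallel>v\<parallel>\<^sup>2 - 2 f v\<close> is bounded below. By the parallelogram law
  \<open>\<parallel>u - v\<parallel>\<^sup>2 = 2 (J u + J v - 2 J ((u + v) / 2))\<close>, so a minimising sequence is Cauchy; at its limit
  the derivative of \<open>J\<close> vanishes, which is the representation.
\<close>

lemma riesz_representation:
  fixes f :: "'a :: {real_inner, complete_space} \<Rightarrow> real"
  assumes "bounded_linear f"
  shows "\<exists>z. \<forall>x. f x = inner x z"
proof -
  interpret f: bounded_linear f by fact
  define J where "J v = (norm v)\<^sup>2 - 2 * f v" for v
  obtain K where K: "\<And>v. norm (f v) \<le> norm v * K"
    using f.bounded by blast
  have lower: "- (K\<^sup>2) \<le> J v" for v
  proof -
    have "f v \<le> norm v * K"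
      using K[of v] by simp
    moreover have "0 \<le> (norm v - K)\<^sup>2"
      by simp
    ultimately show ?thesis
      unfolding J_def by (simp add: power2_diff algebra_simps)
  qed
  define m where "m = Inf (range J)"
  have bdd: "bdd_below (range J)"
    using lower by (auto intro!: bdd_belowI)
  have m_le: "m \<le> J v" for v
    unfolding m_def by (rule cInf_lower[OF _ bdd]) simp
  have parallelogram: "(norm (u - v))\<^sup>2 \<le> 2 * (J u - m) + 2 * (J v - m)" for u v
  proof -
    have "(norm (u - v))\<^sup>2 = 2 * (J u + J v - 2 * J ((1/2) *\<^sub>R (u + v)))"
      unfolding J_def
      by (simp add: f.scaleR f.add power2_norm_eq_inner inner_add inner_diff
          inner_commute algebra_simps)
    then show ?thesis
      using m_le[of "(1/2) *\<^sub>R (u + v)"] by simp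
  qed
  have "\<exists>v. J v < m + inverse (real (Suc n))" for n
  proof -
    have "Inf (range J) < m + inverse (real (Suc n))"
      by (simp add: m_def)
    then show ?thesis
      using cInf_lessD[of "range J"] by blast
  qed
  then obtain v where v: "\<And>n. J (v n) < m + inverse (real (Suc n))"
    by metis
  have "Cauchy v"
  proof (rule metric_CauchyI)
    fix e :: real assume "e > 0"
    then obtain N where N: "inverse (real (Suc N)) < e\<^sup>2 / 4"
      using reals_Archimedean[of "e\<^sup>2 / 4"] by auto
    have "dist (v i) (v j) < e" if "i \<ge> N" "j \<ge> N" for i j
    proof -
      have near: "J (v n) < m + e\<^sup>2 / 4" if "n \<ge> N" for n
      proof -
        have "inverse (real (Suc n)) \<le> inverse (real (Suc N))"
          using that by (intro le_imp_inverse_le) auto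
        then show ?thesis
          using v[of n] N by linarith
      qed
      have "(norm (v i - v j))\<^sup>2 \<le> 2 * (J (v i) - m) + 2 * (J (v j) - m)"
        by (rule parallelogram)
      also have "\<dots> < e\<^sup>2"
        using near[OF that(1)] near[OF that(2)] by argo
      finally have "(norm (v i - v j))\<^sup>2 < e\<^sup>2" .
      then show ?thesis
        using \<open>e > 0\<close> by (simp add: dist_norm power_less_imp_less_base)
    qed
    then show "\<exists>N. \<forall>i\<ge>N. \<forall>j\<ge>N. dist (v i) (v j) < e"
      by blast
  qed
  then obtain z where z: "v \<longlonglongrightarrow> z"
    using Cauchy_convergent convergent_def by blast
  have "(\<lambda>n. J (v n)) \<longlonglongrightarrow> J z"
    unfolding J_def by (intro tendsto_intros z f.tendsto)
  moreover have "(\<lambda>n. m + inverse (real (Suc n))) \<longlonglongrightarrow> m + 0"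
    by (intro tendsto_intros LIMSEQ_inverse_real_of_nat)
  ultimately have "J z \<le> m + 0"
    by (rule LIMSEQ_le) (use v less_imp_le in blast)
  then have J_min: "J z \<le> J w" for w
    using m_le[of w] by simp
  have "f x = inner x z" for x
  proof -
    define d where "d = inner x z - f x"
    have J_shift: "J (z + t *\<^sub>R x) = J z + 2 * t * d + t\<^sup>2 * (norm x)\<^sup>2" for t
      unfolding J_def d_def power2_norm_eq_inner
      by (simp add: f.scaleR f.add inner_add inner_commute power2_eq_square algebra_simps)
    define N where "N = (norm x)\<^sup>2 + 1"
    have "N > 0"
      by (simp add: N_def add_nonneg_pos)
    \<comment> \<open>This \<open>t\<close> minimises \<open>2 t d + t\<^sup>2 N\<close>; adding \<open>1\<close> in \<open>N\<close> covers the case \<open>x = 0\<close>.\<close>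
    define t where "t = - d / N"
    have "0 \<le> 2 * t * d + t\<^sup>2 * (norm x)\<^sup>2"
      using J_min[of "z + t *\<^sub>R x"] J_shift[of t] by simp
    also have "\<dots> \<le> 2 * t * d + t\<^sup>2 * N"
      by (simp add: N_def mult_left_mono)
    also have "\<dots> = - (d\<^sup>2 / N)"
      using \<open>N > 0\<close> by (simp add: t_def field_simps power2_eq_square)
    finally have "d\<^sup>2 / N \<le> 0"
      by simp
    then have "d\<^sup>2 \<le> 0"
      using \<open>N > 0\<close> by (simp add: divide_le_0_iff)
    then show ?thesis
      by (simp add: d_def)
  qed
  then show ?thesis
    by blast
qed

section \<open>Adjoints\<close>

lemma cinner_scaleC_right:
  "cinner x (c *\<^sub>C y) = cnj c * cinner x (y :: 'a :: complex_hilbert)"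
  by (metis cinner_commute cinner_scaleC_left complex_cnj_mult)

lemma inner_scaleC_left:
  "inner (c *\<^sub>C x) y = inner x (cnj c *\<^sub>C (y :: 'a :: complex_hilbert))"
  by (simp add: inner_eq_Re_cinner cinner_scaleC_left cinner_scaleC_right)

text \<open>
  The adjoint for the real inner product commutes with complex scalars, and \<open>cinner\<close> is
  determined by its real part because \<open>Im (cinner a b) = Re (cinner (-\<i> a) b)\<close>.
\<close>

lemma complex_adjoint_exists:
  fixes x :: "'h :: complex_hilbert \<Rightarrow>\<^sub>L 'h"
  assumes "x \<in> bounded_ops"
  shows "\<exists>y\<in>bounded_ops. \<forall>\<xi> \<eta>. cinner (x \<xi>) \<eta> = cinner \<xi> (blinfun_apply y \<eta>)"
proof -
  have x_scaleC: "x (c *\<^sub>C \<xi>) = c *\<^sub>C x \<xi>" for c \<xi>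
    using assms by (simp add: bounded_ops_def)
  have "\<exists>z. \<forall>\<xi>. inner (x \<xi>) \<eta> = inner \<xi> z" for \<eta>
    by (rule riesz_representation)
       (intro bounded_linear_compose[OF bounded_linear_inner_left] blinfun.bounded_linear_right)
  then obtain g where g: "\<And>\<eta> \<xi>. inner (x \<xi>) \<eta> = inner \<xi> (g \<eta>)"
    by metis
  have eqI: "a = b" if "\<And>\<xi>. inner \<xi> a = inner \<xi> b" for a b :: 'h
    using that inner_eq_zero_iff[of "a - b"] by (simp add: inner_diff_right)
  have "bounded_linear g"
  proof (rule bounded_linear_intro[where K = "norm x"])
    show "g (a + b) = g a + g b" for a b
      by (rule eqI) (simp add: inner_add_right flip: g)
    show "g (r *\<^sub>R a) = r *\<^sub>R g a" for r a
      by (rule eqI) (simp flip: g)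
    show "norm (g a) \<le> norm a * norm x" for a
    proof -
      have "norm (g a) * norm (g a) = inner (x (g a)) a"
        by (simp add: g power2_eq_square flip: power2_norm_eq_inner)
      also have "\<dots> \<le> norm (x (g a)) * norm a"
        by (rule norm_cauchy_schwarz)
      also have "\<dots> \<le> norm x * norm (g a) * norm a"
        by (intro mult_right_mono norm_blinfun norm_ge_zero)
      finally have "norm (g a) * norm (g a) \<le> norm (g a) * (norm a * norm x)"
        by (simp add: ac_simps)
      then show ?thesis
        by (cases "norm (g a) = 0") (auto simp: mult_le_cancel_left)
    qed
  qed
  then have apply_g: "blinfun_apply (Blinfun g) = g"
    by (rule bounded_linear_Blinfun_apply)
  have g_scaleC: "g (c *\<^sub>C a) = c *\<^sub>C g a" for c a
  proof (rule eqI)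
    fix \<xi>
    have "inner \<xi> (g (c *\<^sub>C a)) = inner (cnj c *\<^sub>C x \<xi>) a"
      by (simp add: inner_scaleC_left flip: g)
    then show "inner \<xi> (g (c *\<^sub>C a)) = inner \<xi> (c *\<^sub>C g a)"
      by (simp add: inner_scaleC_left g flip: x_scaleC)
  qed
  have Im_eq: "Im (cinner a b) = inner (- \<i> *\<^sub>C a) b" for a b :: 'h
    by (simp add: inner_eq_Re_cinner cinner_scaleC_left)
  have "cinner (x \<xi>) \<eta> = cinner \<xi> (g \<eta>)" for \<xi> \<eta>
  proof (rule complex_eqI)
    show "Re (cinner (x \<xi>) \<eta>) = Re (cinner \<xi> (g \<eta>))"
      using g by (simp add: inner_eq_Re_cinner)
    show "Im (cinner (x \<xi>) \<eta>) = Im (cinner \<xi> (g \<eta>))"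
      by (simp add: Im_eq flip: x_scaleC g)
  qed
  then show ?thesis
    by (intro bexI[of _ "Blinfun g"]) (auto simp: apply_g bounded_ops_def g_scaleC)
qed

lemma op_adj_cinner:
  assumes "x \<in> bounded_ops"
  shows "cinner (blinfun_apply x \<xi>) \<eta> = cinner \<xi> (blinfun_apply (op_adj x) \<eta>)"
proof -
  let ?adj = "\<lambda>y. y \<in> bounded_ops \<and>
    (\<forall>\<xi> \<eta>. cinner (blinfun_apply x \<xi>) \<eta> = cinner \<xi> (blinfun_apply y \<eta>))"
  have unique: "y = z" if y: "?adj y" and z: "?adj z" for y z
  proof (rule blinfun_eqI)
    fix \<eta>
    let ?d = "blinfun_apply y \<eta> - blinfun_apply z \<eta>"
    have "cinner ?d (blinfun_apply y \<eta>) = cinner ?d (blinfun_apply z \<eta>)"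
      using y z by metis
    then have "inner ?d ?d = 0"
      by (simp add: inner_eq_Re_cinner[of ?d] inner_diff_right)
    then show "blinfun_apply y \<eta> = blinfun_apply z \<eta>"
      by simp
  qed
  obtain y where "?adj y"
    using complex_adjoint_exists[OF assms] by blast
  then have "?adj (op_adj x)"
    unfolding op_adj_def by (rule theI) (use unique \<open>?adj y\<close> in blast)
  then show ?thesis
    by blast
qed

lemma inner_op_adj_right:
  assumes "x \<in> bounded_ops"
  shows "inner \<xi> (blinfun_apply (op_adj x) \<eta>) = inner (blinfun_apply x \<xi>) \<eta>"
  by (simp add: inner_eq_Re_cinner op_adj_cinner[OF assms])

lemma inner_op_adj_left:
  assumes "x \<in> bounded_ops"
  shows "inner (blinfun_apply (op_adj x) \<eta>) \<xi> = inner \<eta> (blinfun_apply x \<xi>)"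
  by (metis inner_op_adj_right[OF assms] inner_commute)

lemma complex_hilbert_eq_iff:
  fixes a b :: "'a :: complex_hilbert"
  shows "a = b \<longleftrightarrow> (\<forall>\<xi>. inner \<xi> a = inner \<xi> b)"
  by (metis inner_commute vector_eq_ldot)

text \<open>
  Taking adjoints on both sides turns \<open>ax\<^sup>* = bx\<^sup>*\<close> into \<open>xa\<^sup>* = xb\<^sup>*\<close>. This exchanges the
  operator that stands under the adjoint sign, which decides whether one can pass to a strong limit.
\<close>

lemma comp_adj_eq_swap:
  fixes x a b :: "'h :: complex_hilbert \<Rightarrow>\<^sub>L 'h"
  assumes "x \<in> bounded_ops" "a \<in> bounded_ops" "b \<in> bounded_ops"
  shows "(\<forall>\<eta>. a (op_adj x \<eta>) = b (op_adj x \<eta>)) \<longleftrightarrow> (\<forall>\<eta>. x (op_adj a \<eta>) = x (op_adj b \<eta>))"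
proof -
  have "(\<forall>\<eta>. a (op_adj x \<eta>) = b (op_adj x \<eta>)) \<longleftrightarrow>
      (\<forall>\<eta> \<xi>. inner (op_adj a \<xi>) (op_adj x \<eta>) = inner (op_adj b \<xi>) (op_adj x \<eta>))"
    by (simp add: complex_hilbert_eq_iff inner_op_adj_left assms)
  also have "\<dots> \<longleftrightarrow> (\<forall>\<eta> \<xi>. inner \<xi> (x (op_adj a \<eta>)) = inner \<xi> (x (op_adj b \<eta>)))"
    by (simp add: inner_op_adj_right assms inner_commute) blast
  finally show ?thesis
    by (simp add: complex_hilbert_eq_iff)
qed

section \<open>The star order in terms of vectors\<close>

lemma star_le_iff:
  fixes x y :: "'h :: complex_hilbert \<Rightarrow>\<^sub>L 'h"
  assumes "x \<in> bounded_ops"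
  shows "x \<preceq>\<^sub>* y \<longleftrightarrow> (\<forall>\<xi> \<eta>. inner (x \<xi>) (x \<eta>) = inner (x \<xi>) (y \<eta>)) \<and>
    (\<forall>\<eta>. x (op_adj x \<eta>) = y (op_adj x \<eta>))"
proof -
  have blinfun_eq_iff: "a = b \<longleftrightarrow> (\<forall>\<eta>. a \<eta> = b \<eta>)" for a b :: "'h \<Rightarrow>\<^sub>L 'h"
    by (auto intro: blinfun_eqI)
  have "op_adj x o\<^sub>L x = op_adj x o\<^sub>L y \<longleftrightarrow>
      (\<forall>\<eta> \<xi>. inner \<xi> (op_adj x (x \<eta>)) = inner \<xi> (op_adj x (y \<eta>)))"
    unfolding blinfun_eq_iff by (simp add: complex_hilbert_eq_iff)
  then show ?thesis
    unfolding star_le_def inner_op_adj_right[OF assms] by (simp add: blinfun_eq_iff) blast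
qed

lemma star_le_pythagoras:
  fixes x y :: "'h :: complex_hilbert \<Rightarrow>\<^sub>L 'h"
  assumes "x \<in> bounded_ops" "x \<preceq>\<^sub>* y"
  shows "(norm (y \<xi> - x \<xi>))\<^sup>2 = (norm (y \<xi>))\<^sup>2 - (norm (x \<xi>))\<^sup>2"
proof -
  have "inner (x \<xi>) (x \<xi>) = inner (x \<xi>) (y \<xi>)"
    using assms star_le_iff by blast
  then show ?thesis
    by (simp add: power2_norm_eq_inner inner_diff inner_commute)
qed

lemma star_le_norm_le:
  fixes x y :: "'h :: complex_hilbert \<Rightarrow>\<^sub>L 'h"
  assumes "x \<in> bounded_ops" "x \<preceq>\<^sub>* y"
  shows "norm (x \<xi>) \<le> norm (y \<xi>)"
proof (rule power2_le_imp_le)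
  show "(norm (x \<xi>))\<^sup>2 \<le> (norm (y \<xi>))\<^sup>2"
    using star_le_pythagoras[OF assms, of \<xi>] zero_le_power2[of "norm (y \<xi> - x \<xi>)"] by linarith
qed simp

section \<open>Convergence of nets\<close>

lemma net_filter_neq_bot:
  assumes "directed_set \<Gamma> leq"
  shows "net_filter \<Gamma> leq \<noteq> bot"
proof
  assume "net_filter \<Gamma> leq = bot"
  then have "eventually (\<lambda>_. False) (net_filter \<Gamma> leq)"
    by simp
  then show False
    using assms by (auto simp: eventually_net_filter directed_set_def dest: reflp_onD)
qed

lemma eventually_net_filter_ge:
  assumes "directed_set \<Gamma> leq" "\<alpha> \<in> \<Gamma>" "\<And>\<beta>. \<beta> \<in> \<Gamma> \<Longrightarrow> leq \<alpha> \<beta> \<Longrightarrow> P \<beta>"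
  shows "eventually P (net_filter \<Gamma> leq)"
  using assms by (auto simp: eventually_net_filter)

lemma eventually_net_filter_in:
  assumes "directed_set \<Gamma> leq" "\<And>\<beta>. \<beta> \<in> \<Gamma> \<Longrightarrow> P \<beta>"
  shows "eventually P (net_filter \<Gamma> leq)"
  using assms by (auto simp: eventually_net_filter directed_set_def)

lemma increasing_real_net_tendsto:
  fixes f :: "'i \<Rightarrow> real"
  assumes "directed_set \<Gamma> leq"
    and mono: "\<And>\<alpha> \<beta>. \<alpha> \<in> \<Gamma> \<Longrightarrow> \<beta> \<in> \<Gamma> \<Longrightarrow> leq \<alpha> \<beta> \<Longrightarrow> f \<alpha> \<le> f \<beta>"
    and bound: "\<And>\<alpha>. \<alpha> \<in> \<Gamma> \<Longrightarrow> f \<alpha> \<le> B"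
  shows "(f \<longlongrightarrow> Sup (f ` \<Gamma>)) (net_filter \<Gamma> leq)"
proof (rule order_tendstoI)
  have bdd: "bdd_above (f ` \<Gamma>)"
    using bound by (auto intro!: bdd_aboveI)
  have ne: "f ` \<Gamma> \<noteq> {}"
    using assms(1) by (auto simp: directed_set_def)
  fix a
  show "eventually (\<lambda>\<alpha>. f \<alpha> < a) (net_filter \<Gamma> leq)" if "Sup (f ` \<Gamma>) < a"
    using assms(1) by (rule eventually_net_filter_in) (meson bdd cSUP_upper le_less_trans that)
  show "eventually (\<lambda>\<alpha>. a < f \<alpha>) (net_filter \<Gamma> leq)" if "a < Sup (f ` \<Gamma>)"
  proof -
    obtain \<alpha> where "\<alpha> \<in> \<Gamma>" "a < f \<alpha>"
      using \<open>a < Sup (f ` \<Gamma>)\<close> less_cSup_iff[OF ne bdd] by auto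
    then show ?thesis
      using mono by (intro eventually_net_filter_ge[OF assms(1)]) (auto intro: less_le_trans)
  qed
qed

text \<open>
  Pythagoras bounds the distance of two comparable members by the difference of their squared
  norms; two arbitrary members of a tail are compared through the index at which the tail starts.
\<close>

lemma pythagorean_net_converges:
  fixes v :: "'i \<Rightarrow> 'a :: {real_normed_vector, complete_space}"
  assumes "directed_set \<Gamma> leq"
    and pyth: "\<And>\<alpha> \<beta>. \<alpha> \<in> \<Gamma> \<Longrightarrow> \<beta> \<in> \<Gamma> \<Longrightarrow> leq \<alpha> \<beta> \<Longrightarrow>
      (norm (v \<beta> - v \<alpha>))\<^sup>2 = \<bar>(norm (v \<beta>))\<^sup>2 - (norm (v \<alpha>))\<^sup>2\<bar>"
    and lim: "((\<lambda>\<alpha>. (norm (v \<alpha>))\<^sup>2) \<longlongrightarrow> L) (net_filter \<Gamma> leq)"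
  shows "\<exists>l. (v \<longlongrightarrow> l) (net_filter \<Gamma> leq)"
proof -
  let ?F = "net_filter \<Gamma> leq"
  have "cauchy_filter (filtermap v ?F)"
    unfolding cauchy_filter_metric_filtermap
  proof (intro allI impI)
    fix e :: real assume "e > 0"
    then have "(e / 2)\<^sup>2 / 2 > 0"
      by simp
    with lim have "eventually (\<lambda>\<alpha>. dist ((norm (v \<alpha>))\<^sup>2) L < (e / 2)\<^sup>2 / 2) ?F"
      by (rule tendstoD)
    then obtain \<alpha> where \<alpha>: "\<alpha> \<in> \<Gamma>" and
      near: "\<And>\<beta>. \<beta> \<in> \<Gamma> \<Longrightarrow> leq \<alpha> \<beta> \<Longrightarrow> dist ((norm (v \<beta>))\<^sup>2) L < (e / 2)\<^sup>2 / 2"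
      unfolding eventually_net_filter[OF assms(1)] by blast
    have "leq \<alpha> \<alpha>"
      using assms(1) \<alpha> by (auto simp: directed_set_def dest: reflp_onD)
    have close: "dist (v \<beta>) (v \<alpha>) < e / 2" if "\<beta> \<in> \<Gamma>" "leq \<alpha> \<beta>" for \<beta>
    proof -
      have "(norm (v \<beta> - v \<alpha>))\<^sup>2 < (e / 2)\<^sup>2"
        using near[OF that] near[OF \<alpha> \<open>leq \<alpha> \<alpha>\<close>] pyth[OF \<alpha> that]
        by (simp only: dist_real_def)
      then show ?thesis
        unfolding dist_norm by (rule power_less_imp_less_base) (use \<open>e > 0\<close> in simp)
    qed
    show "\<exists>P. eventually P ?F \<and> (\<forall>\<beta> \<gamma>. P \<beta> \<and> P \<gamma> \<longrightarrow> dist (v \<beta>) (v \<gamma>) < e)"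
    proof (intro exI conjI allI impI)
      show "eventually (\<lambda>\<beta>. dist (v \<beta>) (v \<alpha>) < e / 2) ?F"
        using assms(1) \<alpha> close by (rule eventually_net_filter_ge)
      show "dist (v \<beta>) (v \<gamma>) < e"
        if "dist (v \<beta>) (v \<alpha>) < e / 2 \<and> dist (v \<gamma>) (v \<alpha>) < e / 2" for \<beta> \<gamma>
        using that by (auto intro: dist_triangle_half_l)
    qed
  qed
  moreover have "filtermap v ?F \<noteq> bot"
    using net_filter_neq_bot[OF assms(1)] by (simp add: filtermap_bot_iff)
  ultimately have "\<exists>l. filtermap v ?F \<le> nhds l"
    using cauchy_filter_complete_converges[of _ UNIV] complete_UNIV by auto
  then show ?thesis
    by (simp add: filterlim_def)
qed

lemma tendsto_eventually_eq_imp_eq: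
  fixes a b :: "'a :: t2_space"
  assumes "F \<noteq> bot" "(f \<longlongrightarrow> a) F" "(g \<longlongrightarrow> b) F" "eventually (\<lambda>i. f i = g i) F"
  shows "a = b"
  using tendsto_unique[OF assms(1,2)] tendsto_cong[OF assms(4)] assms(3) by blast

section \<open>Strong limits\<close>

lemma limitin_strong_operator_topology:
  "limitin strong_operator_topology x s F \<longleftrightarrow>
    (\<forall>\<xi>. ((\<lambda>i. blinfun_apply (x i) \<xi>) \<longlongrightarrow> blinfun_apply s \<xi>) F)"
proof -
  have "limitin strong_operator_topology x s F \<longleftrightarrow>
      limitin euclidean (\<lambda>i. blinfun_apply (x i)) (blinfun_apply s) F"
    by (force simp: limitin_def strong_operator_topology_def topspace_pullback_topology
        openin_pullback_topology)
  also have "\<dots> \<longleftrightarrow> (\<forall>\<xi>. ((\<lambda>i. blinfun_apply (x i) \<xi>) \<longlongrightarrow> blinfun_apply s \<xi>) F)"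
    by (subst euclidean_product_topology[symmetric], subst limitin_componentwise) simp
  finally show ?thesis .
qed

lemma limitin_strong_topologyD:
  assumes "limitin strong_topology x s F"
  shows "((\<lambda>i. blinfun_apply (x i) \<xi>) \<longlongrightarrow> blinfun_apply s \<xi>) F"
  using assms
  by (simp add: strong_topology_def limitin_subtopology limitin_strong_operator_topology)

lemma blinfun_pointwise_limit:
  fixes x :: "'i \<Rightarrow> ('a :: real_normed_vector \<Rightarrow>\<^sub>L 'b :: real_normed_vector)"
  assumes "F \<noteq> bot"
    and conv: "\<And>\<xi>. \<exists>l. ((\<lambda>i. x i \<xi>) \<longlongrightarrow> l) F"
    and bound: "\<And>\<xi>. eventually (\<lambda>i. norm (x i \<xi>) \<le> norm \<xi> * K) F"
  shows "\<exists>s. \<forall>\<xi>. ((\<lambda>i. x i \<xi>) \<longlongrightarrow> blinfun_apply s \<xi>) F"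
proof -
  obtain g where g: "\<And>\<xi>. ((\<lambda>i. x i \<xi>) \<longlongrightarrow> g \<xi>) F"
    using conv by metis
  have "bounded_linear g"
  proof (rule bounded_linear_intro)
    show "g (a + b) = g a + g b" for a b
      using tendsto_add[OF g[of a] g[of b]]
      by (intro tendsto_unique[OF assms(1) g]) (simp add: blinfun.add_right)
    show "g (r *\<^sub>R a) = r *\<^sub>R g a" for r a
      using tendsto_scaleR[OF tendsto_const g[of a]]
      by (intro tendsto_unique[OF assms(1) g]) (simp add: blinfun.scaleR_right)
    show "norm (g a) \<le> norm a * K" for a
      by (rule tendsto_upperbound[OF tendsto_norm[OF g] bound assms(1)])
  qed
  then show ?thesis
    using g by (intro exI[of _ "Blinfun g"]) (simp add: bounded_linear_Blinfun_apply)
qed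

lemma strong_limit_in_algebra:
  fixes M :: "('h :: complex_hilbert \<Rightarrow>\<^sub>L 'h) set"
  assumes "von_neumann_algebra M" "F \<noteq> bot"
    and x_in: "eventually (\<lambda>i. x i \<in> M) F"
    and "\<And>\<xi>. \<exists>l. ((\<lambda>i. blinfun_apply (x i) \<xi>) \<longlongrightarrow> l) F"
    and "\<And>\<xi>. eventually (\<lambda>i. norm (blinfun_apply (x i) \<xi>) \<le> norm \<xi> * K) F"
  shows "\<exists>s\<in>M. limitin strong_topology x s F"
proof -
  obtain s where s: "\<And>\<xi>. ((\<lambda>i. blinfun_apply (x i) \<xi>) \<longlongrightarrow> blinfun_apply s \<xi>) F"
    using blinfun_pointwise_limit[OF assms(2,4,5)] by blast
  have M_ops: "M \<subseteq> bounded_ops" and "closedin strong_topology M"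
    using assms(1) by (auto simp: von_neumann_algebra_def cstar_subalgebra_def)
  have x_ops: "eventually (\<lambda>i. x i \<in> bounded_ops) F"
    using x_in by eventually_elim (use M_ops in blast)
  have "s (c *\<^sub>C \<xi>) = c *\<^sub>C s \<xi>" for c \<xi>
    using assms(2) s bounded_linear.tendsto[OF bounded_linear_scaleC s]
  proof (rule tendsto_eventually_eq_imp_eq)
    show "eventually (\<lambda>i. x i (c *\<^sub>C \<xi>) = c *\<^sub>C x i \<xi>) F"
      using x_ops by eventually_elim (simp add: bounded_ops_def)
  qed
  then have "s \<in> bounded_ops"
    by (simp add: bounded_ops_def)
  with s x_ops have lim: "limitin strong_topology x s F"
    by (simp add: strong_topology_def limitin_subtopology limitin_strong_operator_topology)
  then have "s \<in> M"
    using \<open>closedin strong_topology M\<close> x_in assms(2) by (rule limitin_closedin)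
  with lim show ?thesis
    by blast
qed

section \<open>Monotone nets in the star order\<close>

locale vn_net =
  fixes M :: "('h :: complex_hilbert \<Rightarrow>\<^sub>L 'h) set"
    and \<Gamma> :: "'i set" and leq :: "'i \<Rightarrow> 'i \<Rightarrow> bool"
    and x :: "'i \<Rightarrow> ('h \<Rightarrow>\<^sub>L 'h)"
  assumes vn: "von_neumann_algebra M"
    and dir: "directed_set \<Gamma> leq"
    and x_in: "\<And>\<alpha>. \<alpha> \<in> \<Gamma> \<Longrightarrow> x \<alpha> \<in> M"
begin

abbreviation "F \<equiv> net_filter \<Gamma> leq"

lemma M_bounded_ops: "y \<in> M \<Longrightarrow> y \<in> bounded_ops"
  using vn by (auto simp: von_neumann_algebra_def cstar_subalgebra_def)

lemmas x_bounded_ops = M_bounded_ops[OF x_in]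

lemma tail_eq_imp_limit_eq:
  fixes a b :: "'a :: t2_space"
  assumes "\<alpha> \<in> \<Gamma>" "(f \<longlongrightarrow> a) F" "(g \<longlongrightarrow> b) F"
    and "\<And>\<beta>. \<beta> \<in> \<Gamma> \<Longrightarrow> leq \<alpha> \<beta> \<Longrightarrow> f \<beta> = g \<beta>"
  shows "a = b"
  using net_filter_neq_bot[OF dir] assms(2,3) eventually_net_filter_ge[OF dir assms(1,4)]
  by (rule tendsto_eventually_eq_imp_eq)

lemma limit_eq:
  fixes a b :: "'a :: t2_space"
  assumes "(f \<longlongrightarrow> a) F" "(g \<longlongrightarrow> b) F" "\<And>\<beta>. \<beta> \<in> \<Gamma> \<Longrightarrow> f \<beta> = g \<beta>"
  shows "a = b"
  using net_filter_neq_bot[OF dir] assms(1,2) eventually_net_filter_in[OF dir assms(3)]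
  by (rule tendsto_eventually_eq_imp_eq)

lemma increasing_strong_limit_exists:
  assumes inc: "star_increasing_net \<Gamma> leq x"
    and y: "\<And>\<alpha>. \<alpha> \<in> \<Gamma> \<Longrightarrow> x \<alpha> \<preceq>\<^sub>* y"
  shows "\<exists>s\<in>M. limitin strong_topology x s F"
  using vn net_filter_neq_bot[OF dir]
proof (rule strong_limit_in_algebra)
  have le: "x \<alpha> \<preceq>\<^sub>* x \<beta>" if "\<alpha> \<in> \<Gamma>" "\<beta> \<in> \<Gamma>" "leq \<alpha> \<beta>" for \<alpha> \<beta>
    using inc that by (auto simp: star_increasing_net_def)
  have le_y: "norm (x \<alpha> \<xi>) \<le> norm (y \<xi>)" if "\<alpha> \<in> \<Gamma>" for \<alpha> \<xi>
    by (rule star_le_norm_le[OF x_bounded_ops y]) fact+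
  show "eventually (\<lambda>\<alpha>. x \<alpha> \<in> M) F"
    by (rule eventually_net_filter_in[OF dir x_in])
  fix \<xi>
  show "eventually (\<lambda>\<alpha>. norm (x \<alpha> \<xi>) \<le> norm \<xi> * norm y) F"
    using le_y norm_blinfun[of y \<xi>]
    by (intro eventually_net_filter_in[OF dir]) (auto intro: order_trans simp: mult.commute)
  have "((\<lambda>\<alpha>. (norm (x \<alpha> \<xi>))\<^sup>2) \<longlongrightarrow> Sup ((\<lambda>\<alpha>. (norm (x \<alpha> \<xi>))\<^sup>2) ` \<Gamma>)) F"
  proof (rule increasing_real_net_tendsto[OF dir])
    show "(norm (x \<alpha> \<xi>))\<^sup>2 \<le> (norm (x \<beta> \<xi>))\<^sup>2" if "\<alpha> \<in> \<Gamma>" "\<beta> \<in> \<Gamma>" "leq \<alpha> \<beta>" for \<alpha> \<beta>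
      using star_le_norm_le[OF x_bounded_ops le] that by (simp add: power_mono)
    show "(norm (x \<alpha> \<xi>))\<^sup>2 \<le> (norm (y \<xi>))\<^sup>2" if "\<alpha> \<in> \<Gamma>" for \<alpha>
      using le_y[OF that] by (simp add: power_mono)
  qed
  then show "\<exists>l. ((\<lambda>\<alpha>. x \<alpha> \<xi>) \<longlongrightarrow> l) F"
  proof (rule pythagorean_net_converges[OF dir, rotated])
    show "(norm (x \<beta> \<xi> - x \<alpha> \<xi>))\<^sup>2 = \<bar>(norm (x \<beta> \<xi>))\<^sup>2 - (norm (x \<alpha> \<xi>))\<^sup>2\<bar>"
      if "\<alpha> \<in> \<Gamma>" "\<beta> \<in> \<Gamma>" "leq \<alpha> \<beta>" for \<alpha> \<beta>
      using star_le_pythagoras[OF x_bounded_ops le, OF that(1) that, of \<xi>]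
      by (metis abs_of_nonneg zero_le_power2)
  qed
qed

lemma decreasing_strong_limit_exists:
  assumes dec: "star_decreasing_net \<Gamma> leq x"
  shows "\<exists>s\<in>M. limitin strong_topology x s F"
proof -
  have le: "x \<beta> \<preceq>\<^sub>* x \<alpha>" if "\<alpha> \<in> \<Gamma>" "\<beta> \<in> \<Gamma>" "leq \<alpha> \<beta>" for \<alpha> \<beta>
    using dec that by (auto simp: star_decreasing_net_def)
  obtain \<alpha>\<^sub>0 where \<alpha>\<^sub>0: "\<alpha>\<^sub>0 \<in> \<Gamma>"
    using dir by (auto simp: directed_set_def)
  show ?thesis
    using vn net_filter_neq_bot[OF dir]
  proof (rule strong_limit_in_algebra)
    show "eventually (\<lambda>\<alpha>. x \<alpha> \<in> M) F"
      by (rule eventually_net_filter_in[OF dir x_in])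
    fix \<xi>
    have "norm (x \<beta> \<xi>) \<le> norm \<xi> * norm (x \<alpha>\<^sub>0)" if "\<beta> \<in> \<Gamma>" "leq \<alpha>\<^sub>0 \<beta>" for \<beta>
    proof -
      have "norm (x \<beta> \<xi>) \<le> norm (x \<alpha>\<^sub>0 \<xi>)"
        using that \<alpha>\<^sub>0 by (intro star_le_norm_le x_bounded_ops le)
      also have "\<dots> \<le> norm \<xi> * norm (x \<alpha>\<^sub>0)"
        using norm_blinfun[of "x \<alpha>\<^sub>0" \<xi>] by (simp add: mult.commute)
      finally show ?thesis .
    qed
    then show "eventually (\<lambda>\<alpha>. norm (x \<alpha> \<xi>) \<le> norm \<xi> * norm (x \<alpha>\<^sub>0)) F"
      by (rule eventually_net_filter_ge[OF dir \<alpha>\<^sub>0])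
    have "((\<lambda>\<alpha>. - (norm (x \<alpha> \<xi>))\<^sup>2) \<longlongrightarrow> Sup ((\<lambda>\<alpha>. - (norm (x \<alpha> \<xi>))\<^sup>2) ` \<Gamma>)) F"
    proof (rule increasing_real_net_tendsto[OF dir])
      show "- (norm (x \<alpha> \<xi>))\<^sup>2 \<le> - (norm (x \<beta> \<xi>))\<^sup>2" if "\<alpha> \<in> \<Gamma>" "\<beta> \<in> \<Gamma>" "leq \<alpha> \<beta>" for \<alpha> \<beta>
        using star_le_norm_le[OF x_bounded_ops le] that by (simp add: power_mono)
      show "- (norm (x \<alpha> \<xi>))\<^sup>2 \<le> 0" for \<alpha>
        by simp
    qed
    from tendsto_minus[OF this]
    have "((\<lambda>\<alpha>. (norm (x \<alpha> \<xi>))\<^sup>2) \<longlongrightarrow> - Sup ((\<lambda>\<alpha>. - (norm (x \<alpha> \<xi>))\<^sup>2) ` \<Gamma>)) F"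
      by simp
    then show "\<exists>l. ((\<lambda>\<alpha>. x \<alpha> \<xi>) \<longlongrightarrow> l) F"
    proof (rule pythagorean_net_converges[OF dir, rotated])
      show "(norm (x \<beta> \<xi> - x \<alpha> \<xi>))\<^sup>2 = \<bar>(norm (x \<beta> \<xi>))\<^sup>2 - (norm (x \<alpha> \<xi>))\<^sup>2\<bar>"
        if "\<alpha> \<in> \<Gamma>" "\<beta> \<in> \<Gamma>" "leq \<alpha> \<beta>" for \<alpha> \<beta>
        using star_le_pythagoras[OF x_bounded_ops le, OF that(2) that, of \<xi>]
        by (metis abs_minus_commute abs_of_nonneg norm_minus_commute zero_le_power2)
    qed
  qed
qed

lemma increasing_strong_limit_is_lub:
  assumes inc: "star_increasing_net \<Gamma> leq x"
    and "s \<in> M" and lim: "limitin strong_topology x s F"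
  shows "is_lub (star_order M) s (x ` \<Gamma>)"
proof -
  note s_ops = M_bounded_ops[OF \<open>s \<in> M\<close>]
  note tends = limitin_strong_topologyD[OF lim]
  have upper: "x \<alpha> \<preceq>\<^sub>* s" if \<alpha>: "\<alpha> \<in> \<Gamma>" for \<alpha>
    unfolding star_le_iff[OF x_bounded_ops[OF \<alpha>]]
  proof (intro conjI allI)
    note le = inc[unfolded star_increasing_net_def, rule_format, OF \<alpha>,
        unfolded star_le_iff[OF x_bounded_ops[OF \<alpha>]]]
    show "inner (x \<alpha> \<xi>) (x \<alpha> \<eta>) = inner (x \<alpha> \<xi>) (s \<eta>)" for \<xi> \<eta>
      by (rule tail_eq_imp_limit_eq[OF \<alpha> tendsto_const tendsto_inner[OF tendsto_const tends]])
         (use le in blast)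
    show "x \<alpha> (op_adj (x \<alpha>) \<eta>) = s (op_adj (x \<alpha>) \<eta>)" for \<eta>
      by (rule tail_eq_imp_limit_eq[OF \<alpha> tendsto_const tends]) (use le in blast)
  qed
  have least: "s \<preceq>\<^sub>* u" if "u \<in> M" and u: "\<And>\<alpha>. \<alpha> \<in> \<Gamma> \<Longrightarrow> x \<alpha> \<preceq>\<^sub>* u" for u
  proof -
    note u_ops = M_bounded_ops[OF \<open>u \<in> M\<close>]
    have "inner (s \<xi>) (s \<eta>) = inner (s \<xi>) (u \<eta>)" for \<xi> \<eta>
      by (rule limit_eq[OF tendsto_inner[OF tends tends] tendsto_inner[OF tends tendsto_const]])
         (use u star_le_iff x_bounded_ops in blast)
    \<comment> \<open>Both \<open>s\<close> and \<open>u\<close> lie above \<open>x \<alpha>\<close>, so \<open>s (x \<alpha>)\<^sup>* = u (x \<alpha>)\<^sup>*\<close>; swapping frees \<open>x \<alpha>\<close>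
      from the adjoint.\<close>
    moreover have "x \<alpha> (op_adj s \<eta>) = x \<alpha> (op_adj u \<eta>)" if \<alpha>: "\<alpha> \<in> \<Gamma>" for \<alpha> \<eta>
    proof -
      have "\<forall>\<eta>. s (op_adj (x \<alpha>) \<eta>) = u (op_adj (x \<alpha>) \<eta>)"
        using upper[OF \<alpha>] u[OF \<alpha>] unfolding star_le_iff[OF x_bounded_ops[OF \<alpha>]] by metis
      then show ?thesis
        using comp_adj_eq_swap[OF x_bounded_ops[OF \<alpha>] s_ops u_ops] by blast
    qed
    then have "s (op_adj s \<eta>) = s (op_adj u \<eta>)" for \<eta>
      by (rule limit_eq[OF tends tends])
    then have "\<forall>\<eta>. s (op_adj s \<eta>) = u (op_adj s \<eta>)"
      using comp_adj_eq_swap[OF s_ops s_ops u_ops] by blast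
    ultimately show ?thesis
      unfolding star_le_iff[OF s_ops] by blast
  qed
  show ?thesis
    using \<open>s \<in> M\<close> upper least x_in by (subst is_lub_star_order) auto
qed

lemma decreasing_strong_limit_is_glb:
  assumes dec: "star_decreasing_net \<Gamma> leq x"
    and "s \<in> M" and lim: "limitin strong_topology x s F"
  shows "is_glb (star_order M) s (x ` \<Gamma>)"
proof -
  note s_ops = M_bounded_ops[OF \<open>s \<in> M\<close>]
  note tends = limitin_strong_topologyD[OF lim]
  have le: "(\<forall>\<xi> \<eta>. inner (x \<beta> \<xi>) (x \<beta> \<eta>) = inner (x \<beta> \<xi>) (x \<alpha> \<eta>)) \<and>
      (\<forall>\<eta>. x \<beta> (op_adj (x \<beta>) \<eta>) = x \<alpha> (op_adj (x \<beta>) \<eta>))"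
    if "\<alpha> \<in> \<Gamma>" "\<beta> \<in> \<Gamma>" "leq \<alpha> \<beta>" for \<alpha> \<beta>
    using dec that unfolding star_decreasing_net_def
    by (simp flip: star_le_iff[OF x_bounded_ops])
  have lower: "s \<preceq>\<^sub>* x \<alpha>" if \<alpha>: "\<alpha> \<in> \<Gamma>" for \<alpha>
  proof -
    have "inner (s \<xi>) (s \<eta>) = inner (s \<xi>) (x \<alpha> \<eta>)" for \<xi> \<eta>
      by (rule tail_eq_imp_limit_eq[OF \<alpha> tendsto_inner[OF tends tends]
            tendsto_inner[OF tends tendsto_const]]) (use le[OF \<alpha>] in blast)
    \<comment> \<open>The limit is taken twice: first in a further index \<open>\<gamma>\<close> above \<open>\<beta>\<close>, which replaces \<open>x \<gamma>\<close> by
      \<open>s\<close> while \<open>x \<beta>\<close> stays under the adjoint; then, after a swap, in \<open>\<beta>\<close>.\<close>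
    moreover have swapped: "x \<beta> (op_adj s \<eta>) = x \<alpha> (op_adj s \<eta>)"
      if \<beta>: "\<beta> \<in> \<Gamma>" "leq \<alpha> \<beta>" for \<beta> \<eta>
    proof -
      have "x \<gamma> (op_adj (x \<beta>) \<eta>) = x \<gamma> (op_adj (x \<alpha>) \<eta>)" if \<gamma>: "\<gamma> \<in> \<Gamma>" "leq \<beta> \<gamma>" for \<gamma> \<eta>
      proof -
        have "leq \<alpha> \<gamma>"
          using dir \<alpha> \<beta> \<gamma> unfolding directed_set_def by (meson transp_onD)
        then have "\<forall>\<eta>. x \<beta> (op_adj (x \<gamma>) \<eta>) = x \<alpha> (op_adj (x \<gamma>) \<eta>)"
          using le[OF \<alpha> \<gamma>(1)] le[OF \<beta>(1) \<gamma>] by metis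
        then show ?thesis
          using comp_adj_eq_swap x_bounded_ops \<alpha> \<beta>(1) \<gamma>(1) by blast
      qed
      then have "s (op_adj (x \<beta>) \<eta>) = s (op_adj (x \<alpha>) \<eta>)" for \<eta>
        by (rule tail_eq_imp_limit_eq[OF \<beta>(1) tends tends])
      then show ?thesis
        using comp_adj_eq_swap[OF s_ops x_bounded_ops[OF \<beta>(1)] x_bounded_ops[OF \<alpha>]] by blast
    qed
    have "s (op_adj s \<eta>) = x \<alpha> (op_adj s \<eta>)" for \<eta>
      by (rule tail_eq_imp_limit_eq[OF \<alpha> tends tendsto_const swapped])
    ultimately show ?thesis
      unfolding star_le_iff[OF s_ops] by blast
  qed
  have greatest: "u \<preceq>\<^sub>* s" if "u \<in> M" and u: "\<And>\<alpha>. \<alpha> \<in> \<Gamma> \<Longrightarrow> u \<preceq>\<^sub>* x \<alpha>" for u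
    unfolding star_le_iff[OF M_bounded_ops[OF \<open>u \<in> M\<close>]]
  proof (intro conjI allI)
    note u_le = u[unfolded star_le_iff[OF M_bounded_ops[OF \<open>u \<in> M\<close>]]]
    show "inner (u \<xi>) (u \<eta>) = inner (u \<xi>) (s \<eta>)" for \<xi> \<eta>
      by (rule limit_eq[OF tendsto_const tendsto_inner[OF tendsto_const tends]])
         (use u_le in blast)
    show "u (op_adj u \<eta>) = s (op_adj u \<eta>)" for \<eta>
      by (rule limit_eq[OF tendsto_const tends]) (use u_le in blast)
  qed
  show ?thesis
    using \<open>s \<in> M\<close> lower greatest x_in by (subst is_glb_star_order) auto
qed

end

theorem theorem3p5:
  fixes M :: "('h :: complex_hilbert \<Rightarrow>\<^sub>L 'h) set"
    and \<Gamma> :: "'i set" and leq :: "'i \<Rightarrow> 'i \<Rightarrow> bool"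
    and x :: "'i \<Rightarrow> ('h \<Rightarrow>\<^sub>L 'h)"
  assumes "von_neumann_algebra M"
    and "directed_set \<Gamma> leq"
    and "\<And>\<alpha>. \<alpha> \<in> \<Gamma> \<Longrightarrow> x \<alpha> \<in> M"
  shows "(star_increasing_net \<Gamma> leq x \<and> (\<exists>y\<in>M. \<forall>\<alpha>\<in>\<Gamma>. x \<alpha> \<preceq>\<^sub>* y) \<longrightarrow>
      (\<exists>s. limitin strong_topology x s (net_filter \<Gamma> leq) \<and>
           is_lub (star_order M) s (x ` \<Gamma>))) \<and>
    (star_decreasing_net \<Gamma> leq x \<longrightarrow>
      (\<exists>s. limitin strong_topology x s (net_filter \<Gamma> leq) \<and>
           is_glb (star_order M) s (x ` \<Gamma>)))"
proof -
  interpret vn_net M \<Gamma> leq x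
    using assms by unfold_locales
  show ?thesis
    using increasing_strong_limit_exists increasing_strong_limit_is_lub
      decreasing_strong_limit_exists decreasing_strong_limit_is_glb
    by meson
qed

end
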